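(* Let $(X,\Sigma,\mu)$ be a complete $\sigma$-finite measure space, $\mathcal{A}\subseteq\Sigma$ a $\sigma$-finite $\sigma$-subalgebra, $1\le p<\infty$, $u$ a $\Sigma$-measurable weight function, and $\varphi:X\to X$ a non-singular and finitely non-mixing transformation with $\varphi^{-1}\mathcal{A}\subseteq\mathcal{A}$. Suppose the conditional weighted composition operator $T_u:L^p(\Sigma)\to L^p(\mathcal{A})$, $T_uf=E^{\mathcal{A}}(u\,f\circ\varphi)$, is subspace-hypercyclic with respect to $L^p(\mathcal{A})$. Then for each $F\in\mathcal{A}$ with $0<\mu(F)<\infty$ there exist a sequence of $\mathcal{A}$-measurable sets $V_k\subseteq F$ with $\mu(V_k)\to\mu(F)$ as $k\to\infty$ and a sequence of integers $(n_k)$ such that $$\lim_{k\to\infty}\Big\|\Big(\prod_{i=0}^{n_k-1}E^{\mathcal{A}}(u)\circ\varphi^{i}\Big)^{-1}\Big|_{V_k}\Big\|_\infty=0$$ and $$\lim_{k\to\infty}\Big\|\sqrt[p]{h^{\mathcal{A}}_{n_k}}\,\Big[E^{\varphi^{-n_k}(\mathcal{A})}\Big(\prod_{i=0}^{n_k-1}E^{\mathcal{A}}(u)\circ\varphi^{i}\Big)\Big]\circ\varphi^{-n_k}\Big|_{V_k}\Big\|_\infty=0.$$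
   Context: $L^p(\mathcal{A})=L^p(X,\mathcal{A},\mu|_{\mathcal{A}})\subseteq L^p(\Sigma)$; $E^{\mathcal{B}}$ denotes conditional expectation with respect to a $\sigma$-subalgebra $\mathcal{B}$. $\varphi$ is non-singular if $\mu\circ\varphi^{-1}\ll\mu$; it is finitely non-mixing if for every $F\in\Sigma$ of finite measure there is $N\in\mathbb{N}$ with $F\cap\varphi^n(F)=\emptyset$ for all $n>N$. $h^{\mathcal{A}}_n=\frac{d(\mu\circ\varphi^{-n}|_{\mathcal{A}})}{d(\mu|_{\mathcal{A}})}$. For a $\varphi^{-n}(\mathcal{A})$-measurable function $g=g'\circ\varphi^n$, $g\circ\varphi^{-n}$ denotes $g'$ (well defined a.e. on the support of $h^{\mathcal A}_n$). $\|g|_V\|_\infty$ denotes the essential supremum of $|g|$ over $V$. An operator $T$ is subspace-hypercyclic with respect to a closed nontrivial subspace $M$ if some vector $x$ has $\{T^nx:n\ge0\}\cap M$ dense in $M$. *)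

theory Defs
  imports "HOL-Probability.Probability"
begin

definition in_Lp :: "'a measure \<Rightarrow> real \<Rightarrow> ('a \<Rightarrow> real) \<Rightarrow> bool" where
  "in_Lp M p f \<longleftrightarrow> f \<in> borel_measurable M \<and> (\<integral>\<^sup>+ x. ennreal (\<bar>f x\<bar> powr p) \<partial>M) < \<infinity>"

definition in_Lp_sub :: "'a measure \<Rightarrow> 'a measure \<Rightarrow> real \<Rightarrow> ('a \<Rightarrow> real) \<Rightarrow> bool" where
  "in_Lp_sub M A p f \<longleftrightarrow> in_Lp M p f \<and> f \<in> borel_measurable A"

definition Lp_norm :: "'a measure \<Rightarrow> real \<Rightarrow> ('a \<Rightarrow> real) \<Rightarrow> real" where
  "Lp_norm M p f = (enn2real (\<integral>\<^sup>+ x. ennreal (\<bar>f x\<bar> powr p) \<partial>M)) powr (1 / p)"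

definition subspace_hypercyclic ::
  "'a measure \<Rightarrow> real \<Rightarrow> (('a \<Rightarrow> real) \<Rightarrow> ('a \<Rightarrow> real)) \<Rightarrow> (('a \<Rightarrow> real) \<Rightarrow> bool) \<Rightarrow> bool" where
  "subspace_hypercyclic M p T S \<longleftrightarrow>
     (\<exists>x. in_Lp M p x \<and>
        (\<forall>g. S g \<longrightarrow> (\<forall>\<epsilon>>0. \<exists>n. S ((T ^^ n) x) \<and> Lp_norm M p (\<lambda>y. (T ^^ n) x y - g y) < \<epsilon>)))"

definition cwc_op :: "'a measure \<Rightarrow> 'a measure \<Rightarrow> ('a \<Rightarrow> real) \<Rightarrow> ('a \<Rightarrow> 'a)
    \<Rightarrow> ('a \<Rightarrow> real) \<Rightarrow> ('a \<Rightarrow> real)" where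
  "cwc_op M A u \<phi> f = real_cond_exp M A (\<lambda>x. u x * f (\<phi> x))"

definition non_singular :: "'a measure \<Rightarrow> ('a \<Rightarrow> 'a) \<Rightarrow> bool" where
  "non_singular M \<phi> \<longleftrightarrow> absolutely_continuous M (distr M M \<phi>)"

definition finitely_non_mixing :: "'a measure \<Rightarrow> ('a \<Rightarrow> 'a) \<Rightarrow> bool" where
  "finitely_non_mixing M \<phi> \<longleftrightarrow>
     (\<forall>F \<in> sets M. emeasure M F < \<infinity> \<longrightarrow> (\<exists>N::nat. \<forall>n>N. F \<inter> (\<phi> ^^ n) ` F = {}))"

definition h_A :: "'a measure \<Rightarrow> 'a measure \<Rightarrow> ('a \<Rightarrow> 'a) \<Rightarrow> nat \<Rightarrow> 'a \<Rightarrow> ennreal" where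
  "h_A M A \<phi> n = RN_deriv (restr_to_subalg M A)
       (distr (restr_to_subalg M A) (restr_to_subalg M A) (\<phi> ^^ n))"

text \<open>For g = g' o phi^n with g' A-measurable, g o phi^{-n} denotes g'.\<close>
definition comp_inv :: "'a measure \<Rightarrow> 'a measure \<Rightarrow> ('a \<Rightarrow> 'a) \<Rightarrow> nat \<Rightarrow> ('a \<Rightarrow> real) \<Rightarrow> ('a \<Rightarrow> real)" where
  "comp_inv M A \<phi> n g = (SOME g'. g' \<in> borel_measurable A \<and> (\<forall>x\<in>space M. g x = g' ((\<phi> ^^ n) x)))"

definition prodEu :: "'a measure \<Rightarrow> 'a measure \<Rightarrow> ('a \<Rightarrow> real) \<Rightarrow> ('a \<Rightarrow> 'a) \<Rightarrow> nat \<Rightarrow> 'a \<Rightarrow> real" where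
  "prodEu M A u \<phi> n x = (\<Prod>i<n. real_cond_exp M A u ((\<phi> ^^ i) x))"

definition esssup_on :: "'a measure \<Rightarrow> 'a set \<Rightarrow> ('a \<Rightarrow> ereal) \<Rightarrow> ereal" where
  "esssup_on M V g = esssup M (\<lambda>x. if x \<in> V then \<bar>g x\<bar> else 0)"

text \<open>|1/P| with 1/0 = infinity.\<close>
definition inv_abs :: "real \<Rightarrow> ereal" where
  "inv_abs r = inverse (ereal \<bar>r\<bar>)"

definition root_mult :: "real \<Rightarrow> ennreal \<Rightarrow> real \<Rightarrow> ereal" where
  "root_mult p h g = (if h = \<infinity> then (if g = 0 then 0 else \<infinity>)
                      else ereal ((enn2real h) powr (1 / p) * \<bar>g\<bar>))"

end

theory Submission
  imports Defs
begin

text \<open>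
  On \<open>\<A>\<close>-measurable functions \<open>T\<^sup>n f = P\<^sub>n (f \<circ> \<phi>\<^sup>n)\<close>, where \<open>P\<^sub>n\<close> is the product of the
  \<open>E\<^sup>\<A>(u) \<circ> \<phi>\<^sup>i\<close>, \<open>i < n\<close>. Choose \<open>f\<close> in the orbit close to \<open>1\<^sub>F\<close> and then a large \<open>n\<close> with \<open>T\<^sup>n f\<close>
  again close to \<open>1\<^sub>F\<close>. The set \<open>{\<bar>f\<bar> \<ge> \<epsilon> / 2}\<close> has finite measure, so finite non-mixing makes
  \<open>\<phi>\<^sup>n(F)\<close> avoid it, as well as \<open>F\<close>, for large \<open>n\<close>. Hence \<open>f \<circ> \<phi>\<^sup>n\<close> is small on \<open>F\<close> while
  \<open>P\<^sub>n (f \<circ> \<phi>\<^sup>n)\<close> is near \<open>1\<close> on most of it, which makes \<open>P\<^sub>n\<close> large there. For \<open>V \<subseteq> F \<inter> {\<bar>f\<bar> > 1 / 2}\<close>,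
  the integral of \<open>h\<^sub>n \<bar>E(P\<^sub>n) \<circ> \<phi>\<^sup>-\<^sup>n\<bar>\<^sup>p\<close> over \<open>V\<close> equals that of \<open>\<bar>P\<^sub>n\<bar>\<^sup>p\<close> over \<open>\<phi>\<^sup>-\<^sup>n(V)\<close>, which is
  disjoint from \<open>F\<close>; it is therefore bounded by the small integral of \<open>\<bar>2 T\<^sup>n f\<bar>\<^sup>p\<close> outside \<open>F\<close>,
  and Markov's inequality applies.

  The conditional expectation with respect to \<open>\<phi>\<^sup>-\<^sup>n(\<A>)\<close> is meaningful because density of the
  range of \<open>T\<^sup>n\<close> forces \<open>\<phi>\<^sup>-\<^sup>n(\<A>) = \<A>\<close> modulo null sets; in particular \<open>\<phi>\<^sup>-\<^sup>n(\<A>)\<close> is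
  \<open>\<sigma>\<close>-finite and \<open>E(P\<^sub>n) = P\<^sub>n\<close>.
\<close>

section \<open>Iterates of a non-singular map and factorization through a map\<close>

lemma AE_funpow:
  assumes "\<phi> \<in> M \<rightarrow>\<^sub>M M" "non_singular M \<phi>" "AE x in M. Q x"
  shows "AE x in M. Q ((\<phi> ^^ n) x)"
proof (induction n)
  case 0
  then show ?case using assms(3) by simp
next
  case (Suc n)
  have "AE x in distr M M \<phi>. Q ((\<phi> ^^ n) x)"
    using absolutely_continuous_AE[OF _ _ Suc, of "distr M M \<phi>"] assms(2) by (simp add: non_singular_def)
  then have "AE x in M. Q ((\<phi> ^^ n) (\<phi> x))"
    by (rule AE_distrD[OF assms(1)])
  then show ?case by (simp add: funpow_swap1)
qed

lemma measurable_funpow_self: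
  assumes "\<phi> \<in> M \<rightarrow>\<^sub>M M"
  shows "(\<phi> ^^ n) \<in> M \<rightarrow>\<^sub>M M"
  by (induction n) (auto intro: assms measurable_compose)

text \<open>Doob-Dynkin factorization. The level sets of a simple function are preimages under
  \<open>f\<close>, so simple functions factor; \<open>lim\<close>, which is total and preserves
  measurability, carries this over to pointwise limits.\<close>

lemma vimage_algebra_factorization:
  fixes g :: "'a \<Rightarrow> real"
  assumes f: "f \<in> X \<rightarrow> space N" and g: "g \<in> borel_measurable (vimage_algebra X f N)"
  shows "\<exists>g' \<in> borel_measurable N. \<forall>x\<in>X. g x = g' (f x)"
proof -
  obtain s where s: "\<And>i. simple_function (vimage_algebra X f N) (s i)"
    and lim: "\<And>x. x \<in> X \<Longrightarrow> (\<lambda>i. s i x) \<longlonglongrightarrow> g x"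
    using borel_measurable_implies_sequence_metric[OF g, of 0] by (metis space_vimage_algebra)
  have "\<exists>s'\<in>borel_measurable N. \<forall>x\<in>X. s i x = s' (f x)" for i
  proof -
    have "\<exists>B\<in>sets N. s i -` {y} \<inter> X = f -` B \<inter> X" for y
    proof -
      have "s i -` {y} \<inter> X \<in> sets (vimage_algebra X f N)"
        using simple_functionD(2)[OF s[of i], of "{y}"] by simp
      then show ?thesis
        unfolding sets_vimage_algebra2[OF f] by blast
    qed
    then obtain B where B: "\<And>y. B y \<in> sets N" "\<And>y. s i -` {y} \<inter> X = f -` B y \<inter> X"
      by metis
    have fin: "finite (s i ` X)"
      using simple_functionD(1)[OF s[of i]] by simp
    have "s i x = (\<Sum>y\<in>s i ` X. y * indicator (B y) (f x))" if "x \<in> X" for x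
    proof -
      have "(indicator (B y) (f x) :: real) = (if s i x = y then 1 else 0)" for y
        using B(2)[of y] that by (auto simp: indicator_def)
      then have "(\<Sum>y\<in>s i ` X. y * indicator (B y) (f x)) = (\<Sum>y\<in>s i ` X. if s i x = y then y else 0)"
        by (intro sum.cong) auto
      then show ?thesis using fin that by simp
    qed
    moreover have "(\<lambda>z. \<Sum>y\<in>s i ` X. y * indicator (B y) z) \<in> borel_measurable N"
      using B(1) by measurable
    ultimately show ?thesis
      by (intro bexI[of _ "\<lambda>z. \<Sum>y\<in>s i ` X. y * indicator (B y) z"] ballI)
  qed
  then obtain s' where s': "\<And>i. s' i \<in> borel_measurable N" "\<And>i x. x \<in> X \<Longrightarrow> s i x = s' i (f x)"
    by metis
  have "(\<lambda>z. lim (\<lambda>i. s' i z)) \<in> borel_measurable N"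
    using s'(1) by (rule borel_measurable_lim_metric)
  moreover have "g x = lim (\<lambda>i. s' i (f x))" if "x \<in> X" for x
    using limI[OF lim[OF that]] s'(2)[OF that] by simp
  ultimately show ?thesis
    by (intro bexI[of _ "\<lambda>z. lim (\<lambda>i. s' i z)"] ballI)
qed

section \<open>Inequalities for integrals of p-th powers\<close>

lemma abs_add_powr_le:
  fixes a b p :: real
  assumes "0 \<le> p"
  shows "\<bar>a + b\<bar> powr p \<le> 2 powr p * (\<bar>a\<bar> powr p + \<bar>b\<bar> powr p)"
proof -
  have "\<bar>a + b\<bar> powr p \<le> (2 * max \<bar>a\<bar> \<bar>b\<bar>) powr p"
    using assms by (intro powr_mono2) auto
  also have "\<dots> = 2 powr p * max \<bar>a\<bar> \<bar>b\<bar> powr p"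
    by (simp add: powr_mult)
  also have "\<dots> \<le> 2 powr p * (\<bar>a\<bar> powr p + \<bar>b\<bar> powr p)"
    by (intro mult_left_mono) (auto simp: max_def)
  finally show ?thesis .
qed

text \<open>Stands in for Minkowski's inequality: the factor \<open>2 powr p\<close> is harmless,
  and later estimates can work with integrals instead of norms.\<close>

lemma nn_integral_powr_add_le:
  fixes f g :: "'a \<Rightarrow> real"
  assumes [measurable]: "f \<in> borel_measurable M" "g \<in> borel_measurable M" and "0 \<le> p"
  shows "(\<integral>\<^sup>+x. ennreal (\<bar>f x + g x\<bar> powr p) \<partial>M)
    \<le> ennreal (2 powr p) * ((\<integral>\<^sup>+x. ennreal (\<bar>f x\<bar> powr p) \<partial>M) + (\<integral>\<^sup>+x. ennreal (\<bar>g x\<bar> powr p) \<partial>M))"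
proof -
  have "(\<integral>\<^sup>+x. ennreal (\<bar>f x + g x\<bar> powr p) \<partial>M)
      \<le> (\<integral>\<^sup>+x. ennreal (2 powr p) * (ennreal (\<bar>f x\<bar> powr p) + ennreal (\<bar>g x\<bar> powr p)) \<partial>M)"
    using abs_add_powr_le[OF assms(3)]
    by (intro nn_integral_mono) (simp flip: ennreal_plus ennreal_mult add: ennreal_leI)
  then show ?thesis by (simp add: nn_integral_cmult nn_integral_add)
qed

lemma in_Lp_diff:
  assumes "in_Lp M p f" "in_Lp M p g" "0 \<le> p"
  shows "in_Lp M p (\<lambda>x. f x - g x)"
proof -
  have [measurable]: "f \<in> borel_measurable M" "g \<in> borel_measurable M"
    using assms by (auto simp: in_Lp_def)
  have "(\<integral>\<^sup>+x. ennreal (\<bar>f x - g x\<bar> powr p) \<partial>M) < \<infinity>"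
    using nn_integral_powr_add_le[of f M "\<lambda>x. - g x" p] assms
    by (simp add: in_Lp_def ennreal_mult_less_top le_less_trans)
  then show ?thesis by (simp add: in_Lp_def)
qed

lemma in_Lp_add:
  assumes "in_Lp M p f" "in_Lp M p g" "0 \<le> p"
  shows "in_Lp M p (\<lambda>x. f x + g x)"
  using in_Lp_diff[OF assms(1), of "\<lambda>x. - g x"] assms by (simp add: in_Lp_def)

text \<open>\<open>enn2real\<close> sends an infinite integral to 0, so a small
  \<open>Lp_norm\<close> says something about the integral only for a member of L^p.\<close>

lemma Lp_norm_less_imp:
  assumes "in_Lp M p f" "0 < p" "0 < \<delta>" "Lp_norm M p f < \<delta> powr (1 / p)"
  shows "(\<integral>\<^sup>+x. ennreal (\<bar>f x\<bar> powr p) \<partial>M) < ennreal \<delta>"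
proof -
  let ?I = "\<integral>\<^sup>+x. ennreal (\<bar>f x\<bar> powr p) \<partial>M"
  have "enn2real ?I < \<delta>"
    using assms(2-4) powr_mono2[of "1 / p" \<delta> "enn2real ?I"] by (force simp: Lp_norm_def not_le[symmetric])
  moreover have "?I = ennreal (enn2real ?I)"
    using assms(1) by (simp add: in_Lp_def)
  ultimately show ?thesis
    by (metis assms(3) ennreal_less_iff enn2real_nonneg)
qed

lemma Markov_nn_integral:
  assumes [measurable]: "f \<in> borel_measurable M" "B \<in> sets M" and "0 < c" "0 \<le> D"
    and "\<And>x. x \<in> B \<Longrightarrow> ennreal c \<le> f x" and "(\<integral>\<^sup>+x\<in>B. f x \<partial>M) \<le> ennreal D"
  shows "emeasure M B \<le> ennreal (D / c)"
proof -
  have "ennreal c * emeasure M B = (\<integral>\<^sup>+x. ennreal c * indicator B x \<partial>M)"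
    by (simp add: nn_integral_cmult_indicator)
  also have "\<dots> \<le> (\<integral>\<^sup>+x\<in>B. f x \<partial>M)"
    using assms(5) by (intro nn_integral_mono) (auto simp: indicator_def)
  also have "\<dots> \<le> ennreal D" by fact
  finally have *: "ennreal c * emeasure M B \<le> ennreal D" .
  then have "emeasure M B < \<infinity>"
    using \<open>0 < c\<close> by (cases "emeasure M B") (auto simp: ennreal_mult_top top_unique)
  then obtain r where r: "0 \<le> r" "emeasure M B = ennreal r"
    by (cases "emeasure M B") auto
  with * have "c * r \<le> D"
    using assms by (simp flip: ennreal_mult)
  then show ?thesis
    using r \<open>0 < c\<close> by (simp add: ennreal_leI field_simps)
qed

section \<open>Conditional expectation of functions that may fail to be integrable\<close>

context sigma_finite_subalgebra
begin

text \<open>Unlike \<open>real_cond_exp_mult\<close>, no integrability is needed: where \<open>f\<close> has constant sign, each of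
  the two nonnegative conditional expectations gets multiplied by \<open>\<bar>f\<bar>\<close> (and they are swapped if
  \<open>f < 0\<close>), and this survives the truncation of \<open>\<infinity>\<close> to \<open>0\<close> in \<open>enn2real\<close>.\<close>
lemma real_cond_exp_pull_out:
  fixes f g :: "'a \<Rightarrow> real"
  assumes [measurable]: "f \<in> borel_measurable F" "g \<in> borel_measurable M"
  shows "AE x in M. real_cond_exp M F (\<lambda>x. g x * f x) x = real_cond_exp M F g x * f x"
proof -
  have [measurable]: "f \<in> borel_measurable M"
    using assms(1) measurable_from_subalg subalg by blast
  define N where "N = nn_cond_exp M F"
  have key: "AE x in M. N (\<lambda>x. ennreal (k x * f x)) x
      = ennreal (f x) * N (\<lambda>x. ennreal (k x)) x + ennreal (- f x) * N (\<lambda>x. ennreal (- k x)) x"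
    if [measurable]: "k \<in> borel_measurable M" for k :: "'a \<Rightarrow> real"
  proof -
    have eq: "ennreal (k x * f x) = ennreal (f x) * ennreal (k x) + ennreal (- f x) * ennreal (- k x)" for x
      by (cases "0 \<le> f x"; cases "0 \<le> k x")
        (simp_all add: ennreal_neg flip: ennreal_mult, simp_all add: ennreal_neg mult_nonneg_nonpos mult_nonpos_nonneg mult.commute)
    have "AE x in M. N (\<lambda>x. ennreal (f x) * ennreal (k x)) x + N (\<lambda>x. ennreal (- f x) * ennreal (- k x)) x
        = N (\<lambda>x. ennreal (f x) * ennreal (k x) + ennreal (- f x) * ennreal (- k x)) x"
      unfolding N_def by (rule nn_cond_exp_sum) measurable
    moreover have "AE x in M. ennreal (f x) * N (\<lambda>x. ennreal (k x)) x = N (\<lambda>x. ennreal (f x) * ennreal (k x)) x"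
      unfolding N_def by (rule nn_cond_exp_prod) measurable
    moreover have "AE x in M. ennreal (- f x) * N (\<lambda>x. ennreal (- k x)) x = N (\<lambda>x. ennreal (- f x) * ennreal (- k x)) x"
      unfolding N_def by (rule nn_cond_exp_prod) measurable
    ultimately show ?thesis unfolding eq by eventually_elim simp
  qed
  have "AE x in M. N (\<lambda>x. ennreal (- (g x * f x))) x
      = ennreal (f x) * N (\<lambda>x. ennreal (- g x)) x + ennreal (- f x) * N (\<lambda>x. ennreal (g x)) x"
    using key[of "\<lambda>x. - g x"] by simp
  with key[OF assms(2)] show ?thesis
    unfolding real_cond_exp_def N_def
  proof eventually_elim
    case (elim x)
    then show ?case
      by (cases "0 \<le> f x") (simp_all add: ennreal_neg enn2real_mult algebra_simps)
  qed
qed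

text \<open>\<open>f\<close> is pulled out of the conditional expectation of the constant 1, which
  is computed through \<open>nn_cond_exp\<close>; thus \<open>f\<close> may be
  non-integrable.\<close>

lemma real_cond_exp_self:
  fixes f :: "'a \<Rightarrow> real"
  assumes [measurable]: "f \<in> borel_measurable F"
  shows "AE x in M. real_cond_exp M F f x = f x"
proof -
  have "AE x in M. 1 = nn_cond_exp M F (\<lambda>_. 1) x" "AE x in M. 0 = nn_cond_exp M F (\<lambda>_. 0) x"
    by (rule nn_cond_exp_F_meas; simp)+
  then have "AE x in M. real_cond_exp M F (\<lambda>_. 1) x = 1"
    unfolding real_cond_exp_def by eventually_elim (simp add: ennreal_neg)
  with real_cond_exp_pull_out[OF assms, of "\<lambda>_. 1"] show ?thesis
    by fastforce
qed

lemma real_cond_exp_AE_self: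
  fixes f g :: "'a \<Rightarrow> real"
  assumes [measurable]: "f \<in> borel_measurable M" "g \<in> borel_measurable F" and "AE x in M. f x = g x"
  shows "AE x in M. real_cond_exp M F f x = f x"
proof -
  have [measurable]: "g \<in> borel_measurable M"
    using assms(2) measurable_from_subalg subalg by blast
  have "AE x in M. real_cond_exp M F f x = real_cond_exp M F g x"
    using assms(3) by (rule real_cond_exp_cong) measurable
  with real_cond_exp_self[OF assms(2)] assms(3) show ?thesis
    by eventually_elim simp
qed

text \<open>The p-th root of the positive integrable function that sigma-finiteness of the
  restricted measure provides. It serves below as a nowhere vanishing member of L^p that is
  measurable for the subalgebra.\<close>

lemma Ex_pos_powr_integrable:
  assumes "0 < p"
  shows "\<exists>q\<in>borel_measurable F. (\<forall>x\<in>space M. 0 < q x) \<and> (\<integral>\<^sup>+x. ennreal (\<bar>q x\<bar> powr p) \<partial>M) < \<infinity>"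
proof -
  interpret R: sigma_finite_measure "restr_to_subalg M F" by (rule sigma_fin_subalg)
  obtain h where h: "h \<in> borel_measurable (restr_to_subalg M F)" "integral\<^sup>N (restr_to_subalg M F) h \<noteq> \<infinity>"
    "\<And>x. x \<in> space M \<Longrightarrow> 0 < h x \<and> h x < \<infinity>"
    using R.Ex_finite_integrable_function by (auto simp: space_restr_to_subalg)
  have [measurable]: "h \<in> borel_measurable F"
    using measurable_in_subalg'[OF subalg h(1)] .
  have "(\<integral>\<^sup>+x. ennreal (\<bar>enn2real (h x) powr (1 / p)\<bar> powr p) \<partial>M) = (\<integral>\<^sup>+x. h x \<partial>M)"
    using h(3) assms by (intro nn_integral_cong) (auto simp: powr_powr)
  also have "\<dots> < \<infinity>"
    using h(2) by (simp add: nn_integral_subalgebra2[OF subalg] less_top)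
  finally have *: "(\<integral>\<^sup>+x. ennreal (\<bar>enn2real (h x) powr (1 / p)\<bar> powr p) \<partial>M) < \<infinity>" .
  have "0 < enn2real (h x)" if "x \<in> space M" for x
    using h(3)[OF that] by (simp add: enn2real_positive_iff)
  then have "\<forall>x\<in>space M. 0 < enn2real (h x) powr (1 / p)"
    by (metis powr_gt_zero less_irrefl)
  with * show ?thesis
    by (intro bexI[of _ "\<lambda>x. enn2real (h x) powr (1 / p)"]) auto
qed

end

section \<open>Bounds for the extended-real quantities and their essential suprema\<close>

lemma root_mult_le:
  assumes "0 < p" "0 < \<epsilon>" and le: "h * ennreal (\<bar>g\<bar> powr p) \<le> ennreal (\<epsilon> powr p)"
  shows "\<bar>root_mult p h g\<bar> \<le> ereal \<epsilon>"
proof (cases h)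
  case (real r)
  then have "r * \<bar>g\<bar> powr p \<le> \<epsilon> powr p"
    using le by (simp flip: ennreal_mult)
  then have "(r * \<bar>g\<bar> powr p) powr (1 / p) \<le> (\<epsilon> powr p) powr (1 / p)"
    using assms real by (intro powr_mono2) auto
  then have "r powr (1 / p) * \<bar>g\<bar> \<le> \<epsilon>"
    using assms real by (simp add: powr_mult powr_powr)
  then show ?thesis
    using real by (simp add: root_mult_def)
next
  case top
  \<comment> \<open>An infinite \<open>h\<close> violates the bound unless \<open>g = 0\<close>, and
    then \<open>root_mult\<close> is 0 by convention.\<close>
  then have "g = 0"
    using le by (cases "g = 0") (auto simp: ennreal_top_mult top_unique)
  then show ?thesis
    using assms top by (simp add: root_mult_def)
qed

lemma inv_abs_le:
  assumes "0 < \<epsilon>" "1 / \<epsilon> \<le> \<bar>r\<bar>"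
  shows "\<bar>inv_abs r\<bar> \<le> ereal \<epsilon>"
proof -
  have "0 < \<bar>r\<bar>"
    using assms by (intro less_le_trans[OF _ assms(2)]) simp
  then have "inverse \<bar>r\<bar> \<le> \<epsilon>"
    using assms by (simp add: field_simps)
  then show ?thesis
    using \<open>0 < \<bar>r\<bar>\<close> by (simp add: inv_abs_def)
qed

text \<open>On a null space every number is an essential upper bound and the supremum is minus
  infinity, which the hypothesis excludes. Non-measurable functions get the value infinity.\<close>

lemma esssup_on_nonneg:
  assumes "emeasure M (space M) \<noteq> 0"
  shows "0 \<le> esssup_on M V g"
proof (cases "(\<lambda>x. if x \<in> V then \<bar>g x\<bar> else 0) \<in> borel_measurable M")
  case True
  have "(0::ereal) = esssup M (\<lambda>x. 0)"
    using esssup_const[OF assms] by simp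
  also have "\<dots> \<le> esssup_on M V g"
    unfolding esssup_on_def by (rule esssup_mono) auto
  finally show ?thesis .
qed (simp add: esssup_on_def esssup_non_measurable)

lemma esssup_on_le:
  assumes [measurable]: "g \<in> borel_measurable M" "V \<in> sets M"
    and "\<And>x. x \<in> V \<Longrightarrow> \<bar>g x\<bar> \<le> c" "0 \<le> c"
  shows "esssup_on M V g \<le> c"
  unfolding esssup_on_def using assms(3,4) by (intro esssup_I) auto

section \<open>Iterates of the operator and change of variables\<close>

locale weighted_composition = sigma_finite_subalgebra M A for M A :: "'a measure" +
  fixes p :: real and u :: "'a \<Rightarrow> real" and \<phi> :: "'a \<Rightarrow> 'a"
  assumes p_ge_1: "1 \<le> p"
    and u_measurable [measurable]: "u \<in> borel_measurable M"
    and \<phi>_measurable [measurable]: "\<phi> \<in> M \<rightarrow>\<^sub>M M"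
    and \<phi>_non_singular: "non_singular M \<phi>"
    and \<phi>_vimage: "B \<in> sets A \<Longrightarrow> \<phi> -` B \<inter> space M \<in> sets A"
begin

abbreviation T :: "('a \<Rightarrow> real) \<Rightarrow> 'a \<Rightarrow> real" where "T \<equiv> cwc_op M A u \<phi>"
abbreviation P :: "nat \<Rightarrow> 'a \<Rightarrow> real" where "P \<equiv> prodEu M A u \<phi>"

lemma space_A: "space A = space M"
  using subalg by (simp add: subalgebra_def)

lemma sets_A: "B \<in> sets A \<Longrightarrow> B \<in> sets M"
  using subalg by (auto simp: subalgebra_def)

lemma borel_A: "f \<in> borel_measurable A \<Longrightarrow> f \<in> borel_measurable M"
  by (rule measurable_from_subalg[OF subalg])

lemma \<phi>_measurable_A: "\<phi> \<in> A \<rightarrow>\<^sub>M A"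
  using \<phi>_vimage measurable_space[OF \<phi>_measurable] by (intro measurableI) (auto simp: space_A)

lemma funpow_measurable_A [measurable]: "(\<phi> ^^ n) \<in> A \<rightarrow>\<^sub>M A"
  by (rule measurable_funpow_self[OF \<phi>_measurable_A])

lemma funpow_measurable [measurable]: "(\<phi> ^^ n) \<in> M \<rightarrow>\<^sub>M M"
  by (rule measurable_funpow_self[OF \<phi>_measurable])

lemma prodEu_measurable_A [measurable]: "P n \<in> borel_measurable A"
  unfolding prodEu_def by measurable

lemma prodEu_measurable [measurable]: "P n \<in> borel_measurable M"
  by (rule borel_A) measurable

text \<open>If \<open>f\<close> is \<open>A\<close>-measurable, so is its composition with
  \<open>\<phi>\<close>, which can be pulled out: \<open>T f\<close> is the conditional expectation
  of \<open>u\<close> times that composition. In the induction, non-singularity transports the a.e.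
  equality through \<open>\<phi>\<close>.\<close>

lemma cwc_iterate_eq:
  assumes [measurable]: "f \<in> borel_measurable A"
  shows "AE y in M. (T ^^ n) f y = P n y * f ((\<phi> ^^ n) y)"
proof -
  have m: "(T ^^ n) f \<in> borel_measurable A" for n
    by (cases n) (auto simp: cwc_op_def assms)
  show "AE y in M. (T ^^ n) f y = P n y * f ((\<phi> ^^ n) y)"
  proof (induction n)
    case 0
    then show ?case by (simp add: prodEu_def)
  next
    case (Suc n)
    have "AE y in M. T ((T ^^ n) f) y = real_cond_exp M A u y * (T ^^ n) f (\<phi> y)"
      unfolding cwc_op_def[of M A u \<phi> "(T ^^ n) f"]
      by (intro real_cond_exp_pull_out measurable_compose[OF \<phi>_measurable_A] m u_measurable)
    moreover have "AE y in M. (T ^^ n) f (\<phi> y) = P n (\<phi> y) * f ((\<phi> ^^ n) (\<phi> y))"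
      using AE_funpow[OF \<phi>_measurable \<phi>_non_singular Suc, of 1] by simp
    ultimately have *: "AE y in M. T ((T ^^ n) f) y
        = real_cond_exp M A u y * (P n (\<phi> y) * f ((\<phi> ^^ n) (\<phi> y)))"
      by eventually_elim simp
    have \<phi>_Suc: "(\<phi> ^^ Suc k) y = (\<phi> ^^ k) (\<phi> y)" for k y
      by (simp only: funpow_Suc_right o_apply)
    have P_Suc: "P (Suc n) y = real_cond_exp M A u y * P n (\<phi> y)" for y
      unfolding prodEu_def prod.lessThan_Suc_shift \<phi>_Suc by simp
    have T_Suc: "(T ^^ Suc n) f = T ((T ^^ n) f)"
      by simp
    show ?case
      unfolding \<phi>_Suc P_Suc T_Suc using * by (simp only: mult.assoc)
  qed
qed

text \<open>This is \<open>\<integral> k d\<nu> = \<integral> h k d\<mu>\<close> for \<open>\<nu> = \<mu> \<circ> \<phi>\<^sup>-\<^sup>n\<close>; the measure \<open>\<nu>\<close> need not be \<open>\<sigma>\<close>-finite.\<close>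
lemma nn_integral_h_A:
  assumes [measurable]: "k \<in> borel_measurable A"
  shows "(\<integral>\<^sup>+y. h_A M A \<phi> n y * k y \<partial>M) = (\<integral>\<^sup>+y. k ((\<phi> ^^ n) y) \<partial>M)"
proof -
  let ?R = "restr_to_subalg M A"
  have sets_R: "sets ?R = sets A"
    by (rule sets_restr_to_subalg[OF subalg])
  have \<phi>_R: "(\<phi> ^^ n) \<in> ?R \<rightarrow>\<^sub>M ?R"
    using funpow_measurable_A by (simp cong: measurable_cong_sets add: sets_R)
  have k_R: "k \<in> borel_measurable ?R"
    by (rule measurable_in_subalg[OF subalg assms])
  \<comment> \<open>Non-singularity is given on \<open>M\<close>; it passes to the restricted
    measure because its null sets are exactly the \<open>A\<close>-sets that are null for
    \<open>M\<close>.\<close>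
  have ac: "absolutely_continuous ?R (distr ?R ?R (\<phi> ^^ n))"
    unfolding absolutely_continuous_def
  proof
    fix B assume B: "B \<in> null_sets ?R"
    then have [measurable]: "B \<in> sets A" "B \<in> sets M" and "B \<in> null_sets M"
      by (auto simp: null_sets_restr_to_subalg[OF subalg] sets_A)
    then have "AE y in M. (\<phi> ^^ n) y \<notin> B"
      by (intro AE_funpow[OF \<phi>_measurable \<phi>_non_singular] AE_not_in)
    then have "AE y in M. y \<notin> (\<phi> ^^ n) -` B \<inter> space M"
      by eventually_elim simp
    then have "(\<phi> ^^ n) -` B \<inter> space M \<in> null_sets M"
      using measurable_sets[OF funpow_measurable \<open>B \<in> sets M\<close>] by (simp add: AE_iff_null_sets)
    moreover have "(\<phi> ^^ n) -` B \<inter> space M \<in> sets A"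
      using measurable_sets[OF funpow_measurable_A \<open>B \<in> sets A\<close>] by (simp add: space_A)
    ultimately show "B \<in> null_sets (distr ?R ?R (\<phi> ^^ n))"
      using \<phi>_R \<open>B \<in> sets A\<close>
      by (simp add: null_sets_def emeasure_distr sets_R space_restr_to_subalg emeasure_restr_to_subalg[OF subalg])
  qed
  have "(\<integral>\<^sup>+y. k ((\<phi> ^^ n) y) \<partial>M) = (\<integral>\<^sup>+y. k ((\<phi> ^^ n) y) \<partial>?R)"
    by (rule nn_integral_subalgebra2[OF subalg, symmetric]) measurable
  also have "\<dots> = (\<integral>\<^sup>+y. k y \<partial>distr ?R ?R (\<phi> ^^ n))"
    using k_R \<phi>_R by (simp add: nn_integral_distr)
  also have "\<dots> = (\<integral>\<^sup>+y. h_A M A \<phi> n y * k y \<partial>?R)"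
    unfolding h_A_def
    by (rule sigma_finite_measure.RN_deriv_nn_integral[OF sigma_fin_subalg ac _ k_R]) simp
  also have "\<dots> = (\<integral>\<^sup>+y. h_A M A \<phi> n y * k y \<partial>M)"
    using measurable_in_subalg'[OF subalg, of "h_A M A \<phi> n" borel]
    by (intro nn_integral_subalgebra2[OF subalg]) (simp add: h_A_def)
  finally show ?thesis ..
qed

lemma h_A_measurable_A [measurable]: "h_A M A \<phi> n \<in> borel_measurable A"
  by (rule measurable_in_subalg'[OF subalg]) (simp add: h_A_def)

text \<open>The factorization lemma makes the choice in \<open>comp_inv\<close> meaningful. The
  chosen function is determined only on the range of \<open>\<phi> ^^ n\<close>.\<close>

lemma comp_inv:
  assumes "g \<in> borel_measurable (vimage_algebra (space M) (\<phi> ^^ n) A)"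
  shows comp_inv_measurable: "comp_inv M A \<phi> n g \<in> borel_measurable A"
    and comp_inv_eq: "y \<in> space M \<Longrightarrow> comp_inv M A \<phi> n g ((\<phi> ^^ n) y) = g y"
proof -
  have "(\<phi> ^^ n) \<in> space M \<rightarrow> space A"
    using measurable_space[OF funpow_measurable] by (auto simp: space_A)
  then have "\<exists>g'. g' \<in> borel_measurable A \<and> (\<forall>y\<in>space M. g y = g' ((\<phi> ^^ n) y))"
    using vimage_algebra_factorization[OF _ assms] by blast
  then have *: "comp_inv M A \<phi> n g \<in> borel_measurable A
      \<and> (\<forall>y\<in>space M. g y = comp_inv M A \<phi> n g ((\<phi> ^^ n) y))"
    unfolding comp_inv_def by (rule someI_ex)
  show "comp_inv M A \<phi> n g \<in> borel_measurable A"
    using * by (rule conjunct1)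
  show "comp_inv M A \<phi> n g ((\<phi> ^^ n) y) = g y" if "y \<in> space M"
    by (rule sym, rule bspec[OF conjunct2[OF *] that])
qed

end

section \<open>The orbit of the hypercyclic vector and the range of the iterates\<close>

locale hypercyclic_composition = weighted_composition +
  fixes x :: "'a \<Rightarrow> real" and F :: "'a set"
  assumes T_maps: "in_Lp M p f \<Longrightarrow> in_Lp_sub M A p (T f)"
    and x_Lp: "in_Lp M p x"
    and orbit_dense: "in_Lp_sub M A p g \<Longrightarrow> 0 < \<epsilon> \<Longrightarrow>
      \<exists>n. in_Lp_sub M A p ((T ^^ n) x) \<and> Lp_norm M p (\<lambda>y. (T ^^ n) x y - g y) < \<epsilon>"
    and F_sets: "F \<in> sets A" and F_pos: "0 < emeasure M F" and F_finite: "emeasure M F < \<infinity>"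
begin

lemma F_sets_M [measurable]: "F \<in> sets M"
  using F_sets by (rule sets_A)

lemma orbit_Lp: "in_Lp M p ((T ^^ n) x)"
  by (induction n) (use x_Lp T_maps in \<open>auto simp: in_Lp_sub_def\<close>)

lemma orbit_Lp_sub: "1 \<le> n \<Longrightarrow> in_Lp_sub M A p ((T ^^ n) x)"
  using T_maps[OF orbit_Lp] by (cases n) auto

lemma orbit_measurable_A: "1 \<le> n \<Longrightarrow> (T ^^ n) x \<in> borel_measurable A"
  using orbit_Lp_sub by (simp add: in_Lp_sub_def)

text \<open>The condition on \<open>m\<close> matters: \<open>x\<close> itself is only
  \<open>M\<close>-measurable, and the product formula holds for \<open>A\<close>-measurable
  functions.\<close>

lemma orbit_eq:
  assumes "1 \<le> m"
  shows "AE y in M. (T ^^ (n + m)) x y = P n y * (T ^^ m) x ((\<phi> ^^ n) y)"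
  using cwc_iterate_eq[OF orbit_measurable_A[OF assms]] by (simp add: funpow_add)

lemma nn_integral_indicator_powr:
  "(\<integral>\<^sup>+y. ennreal (\<bar>c * indicator F y\<bar> powr p) \<partial>M) = ennreal (\<bar>c\<bar> powr p * measure M F)"
proof -
  have "(\<integral>\<^sup>+y. ennreal (\<bar>c * indicator F y\<bar> powr p) \<partial>M) = (\<integral>\<^sup>+y. ennreal (\<bar>c\<bar> powr p) * indicator F y \<partial>M)"
    using p_ge_1 by (intro nn_integral_cong) (auto simp: indicator_def)
  then show ?thesis
    using F_finite by (simp add: nn_integral_cmult_indicator emeasure_eq_ennreal_measure ennreal_mult)
qed

lemma indicator_Lp_sub: "in_Lp_sub M A p (\<lambda>y. c * indicator F y)"
  using F_sets nn_integral_indicator_powr[of c] by (auto simp: in_Lp_sub_def in_Lp_def)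

lemma Lp_sub_add:
  "in_Lp_sub M A p f \<Longrightarrow> in_Lp_sub M A p g \<Longrightarrow> in_Lp_sub M A p (\<lambda>y. f y + g y)"
  using in_Lp_add[of M p f g] p_ge_1 by (auto simp: in_Lp_sub_def)

text \<open>Since \<open>g + t 1\<^sub>F\<close> is close to \<open>g\<close>, the subspace has no isolated points, so that finitely many
  elements of the orbit are dispensable.\<close>
lemma orbit_tail_dense:
  assumes "in_Lp_sub M A p g" "0 < \<delta>"
  shows "\<exists>n\<ge>N. (\<integral>\<^sup>+y. ennreal (\<bar>(T ^^ n) x y - g y\<bar> powr p) \<partial>M) < ennreal \<delta>"
  using assms
proof (induction N arbitrary: g \<delta>)
  case 0
  then obtain n where n: "Lp_norm M p (\<lambda>y. (T ^^ n) x y - g y) < \<delta> powr (1 / p)"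
    using orbit_dense[OF 0(1), of "\<delta> powr (1 / p)"] by auto
  have "in_Lp M p (\<lambda>y. (T ^^ n) x y - g y)"
    using in_Lp_diff[OF orbit_Lp] 0 p_ge_1 by (auto simp: in_Lp_sub_def)
  from Lp_norm_less_imp[OF this _ 0(2) n] show ?case
    using p_ge_1 by auto
next
  case (Suc N)
  have [measurable]: "g \<in> borel_measurable M" "(T ^^ n) x \<in> borel_measurable M" for n
    using Suc.prems(1) orbit_Lp by (auto simp: in_Lp_sub_def in_Lp_def)
  define m where "m = measure M F"
  define C where "C = 2 powr p"
  \<comment> \<open>\<open>C\<close> is the constant of the weak triangle inequality.
    \<open>t\<close> is chosen so that the p-th power integral of \<open>t\<close> times the
    indicator of \<open>F\<close> is \<open>d\<close>, small against \<open>\<delta>\<close>;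
    \<open>\<delta>'\<close> is in turn small against \<open>d\<close>.\<close>
  define d where "d = \<delta> / (4 * C)"
  define t where "t = (d / m) powr (1 / p)"
  have "0 < m"
    using F_pos F_finite by (auto simp: m_def measure_def enn2real_positive_iff)
  have "1 \<le> C"
    using p_ge_1 by (simp add: C_def ge_one_powr_ge_zero)
  then have "0 < d"
    using \<open>0 < \<delta>\<close> by (simp add: d_def)
  then have t: "\<bar>t\<bar> powr p * m = d"
    using \<open>0 < m\<close> p_ge_1 by (simp add: t_def powr_powr)
  define \<delta>' where "\<delta>' = d / (4 * C)"
  have "0 < \<delta>'" "\<delta>' \<le> d"
    using \<open>0 < d\<close> \<open>1 \<le> C\<close> by (auto simp: \<delta>'_def divide_le_eq)
  have "d < \<delta>"
    using \<open>0 < \<delta>\<close> \<open>1 \<le> C\<close> unfolding d_def by (simp add: divide_less_eq)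
  let ?I = "\<lambda>f. \<integral>\<^sup>+y. ennreal (\<bar>f y\<bar> powr p) \<partial>M"
  have It: "?I (\<lambda>y. c * indicator F y) = ennreal d" if "\<bar>c\<bar> = \<bar>t\<bar>" for c
    using nn_integral_indicator_powr[of c] t that by (simp add: m_def)
  obtain n1 where n1: "n1 \<ge> N" "?I (\<lambda>y. (T ^^ n1) x y - g y) < ennreal \<delta>'"
    using Suc.IH[OF Suc.prems(1) \<open>0 < \<delta>'\<close>] by auto
  obtain n2 where n2: "n2 \<ge> N" "?I (\<lambda>y. (T ^^ n2) x y - (g y + t * indicator F y)) < ennreal \<delta>'"
    using Suc.IH[OF Lp_sub_add[OF Suc.prems(1) indicator_Lp_sub] \<open>0 < \<delta>'\<close>, of t] by auto
  show ?case
  proof (cases "n1 = N \<and> n2 = N")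
    case True
    \<comment> \<open>One element cannot be close to both targets: their separation \<open>d\<close>
      would be at most \<open>2 * C * \<delta>' = d / 2\<close>.\<close>
    have "ennreal d = ?I (\<lambda>y. ((T ^^ N) x y - g y) + - ((T ^^ N) x y - (g y + t * indicator F y)))"
      using It[of t] by simp
    also have "\<dots> \<le> ennreal C * (?I (\<lambda>y. (T ^^ N) x y - g y)
        + ?I (\<lambda>y. - ((T ^^ N) x y - (g y + t * indicator F y))))"
      unfolding C_def using p_ge_1 by (intro nn_integral_powr_add_le) auto
    also have "\<dots> \<le> ennreal C * (ennreal \<delta>' + ennreal \<delta>')"
      using n1(2) n2(2) True by (intro mult_left_mono add_mono) (auto simp: abs_minus_commute)
    also have "\<dots> = ennreal (C * (\<delta>' + \<delta>'))"
      using \<open>0 < \<delta>'\<close> \<open>1 \<le> C\<close> by (simp flip: ennreal_plus ennreal_mult)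
    also have "C * (\<delta>' + \<delta>') = d / 2"
      using \<open>1 \<le> C\<close> by (simp add: \<delta>'_def field_simps)
    finally show ?thesis
      using \<open>0 < d\<close> by simp
  next
    case False
    consider "n1 \<ge> Suc N" | "n2 \<ge> Suc N"
      using False n1(1) n2(1) by linarith
    then show ?thesis
    proof cases
      case 1
      have "ennreal \<delta>' \<le> ennreal \<delta>"
        using \<open>\<delta>' \<le> d\<close> \<open>d < \<delta>\<close> by (intro ennreal_leI) simp
      with 1 n1(2) show ?thesis by (meson less_le_trans)
    next
      case 2
      have "?I (\<lambda>y. (T ^^ n2) x y - g y)
          = ?I (\<lambda>y. ((T ^^ n2) x y - (g y + t * indicator F y)) + t * indicator F y)"
        by simp
      also have "\<dots> \<le> ennreal C * (?I (\<lambda>y. (T ^^ n2) x y - (g y + t * indicator F y))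
          + ?I (\<lambda>y. t * indicator F y))"
        unfolding C_def using p_ge_1 by (intro nn_integral_powr_add_le) auto
      also have "\<dots> \<le> ennreal C * (ennreal d + ennreal d)"
        using n2(2) It[of t] \<open>\<delta>' \<le> d\<close>
        by (intro mult_left_mono add_mono) (auto intro: order_trans[OF less_imp_le] ennreal_leI)
      also have "\<dots> = ennreal (C * (d + d))"
        using \<open>0 < d\<close> \<open>1 \<le> C\<close> by (simp flip: ennreal_plus ennreal_mult)
      also have "C * (d + d) = \<delta> / 2"
        using \<open>1 \<le> C\<close> by (simp add: d_def field_simps)
      also have "ennreal (\<delta> / 2) < ennreal \<delta>"
        using \<open>0 < \<delta>\<close> by (simp add: ennreal_less_iff)
      finally show ?thesis
        using 2 by auto
    qed
  qed
qed

text \<open>Orbit elements of index above \<open>n\<close> converge to \<open>g\<close> in norm,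
  hence a.e. along a subsequence, and each factors as \<open>P n\<close> times an
  \<open>A\<close>-measurable function composed with \<open>\<phi> ^^ n\<close>.\<close>

lemma range_dense_AE:
  assumes "in_Lp_sub M A p g"
  shows "\<exists>a. (\<forall>k. a k \<in> borel_measurable A) \<and>
    (AE y in M. (\<lambda>k. P n y * a k ((\<phi> ^^ n) y)) \<longlonglongrightarrow> g y)"
proof -
  have [measurable]: "g \<in> borel_measurable M" "(T ^^ n) x \<in> borel_measurable M" for n
    using assms orbit_Lp by (auto simp: in_Lp_sub_def in_Lp_def)
  \<comment> \<open>The bound \<open>n + 1\<close>, not \<open>n\<close>, leaves at least one
    application of \<open>T\<close> after splitting off \<open>T ^^ n\<close>, so the remaining
    factor is \<open>A\<close>-measurable.\<close>
  have "\<exists>j\<ge>n + 1. (\<integral>\<^sup>+y. ennreal (\<bar>(T ^^ j) x y - g y\<bar> powr p) \<partial>M) < ennreal (1 / Suc k)" for k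
    by (rule orbit_tail_dense[OF assms]) simp
  then obtain j where j: "\<And>k. j k \<ge> n + 1"
    "\<And>k. (\<integral>\<^sup>+y. ennreal (\<bar>(T ^^ j k) x y - g y\<bar> powr p) \<partial>M) < ennreal (1 / Suc k)"
    by metis
  define c where "c k y = \<bar>(T ^^ j k) x y - g y\<bar> powr p" for k y
  have int: "integrable M (c k)" for k
    using j(2)[of k] unfolding c_def
    by (intro integrableI_nonneg) (auto intro: less_trans[OF _ ennreal_less_top])
  have bound: "(\<integral>y. norm (c k y) \<partial>M) \<le> 1 / Suc k" for k
  proof -
    have "ennreal (\<integral>y. norm (c k y) \<partial>M) = (\<integral>\<^sup>+y. ennreal (c k y) \<partial>M)"
      using nn_integral_eq_integral[OF int[of k]] by (simp add: c_def[abs_def])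
    also have "\<dots> \<le> ennreal (1 / Suc k)"
      using j(2)[of k] by (simp add: c_def)
    finally show ?thesis by (simp add: ennreal_le_iff del: of_nat_Suc)
  qed
  have "(\<lambda>k. \<integral>y. norm (c k y) \<partial>M) \<longlonglongrightarrow> 0"
    by (rule real_tendsto_sandwich[OF _ _ tendsto_const LIMSEQ_inverse_real_of_nat])
      (use bound in \<open>auto simp: inverse_eq_divide\<close>)
  from tendsto_L1_AE_subseq[OF int this]
  obtain r where r: "AE y in M. (\<lambda>k. c (r k) y) \<longlonglongrightarrow> 0" by auto
  define a where "a k = (T ^^ (j (r k) - n)) x" for k
  have "a k \<in> borel_measurable A" for k
    unfolding a_def using j(1)[of "r k"] by (intro orbit_measurable_A) simp
  moreover have "AE y in M. (T ^^ j (r k)) x y = P n y * a k ((\<phi> ^^ n) y)" for k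
    using orbit_eq[of "j (r k) - n" n] j(1)[of "r k"] by (simp add: a_def)
  then have "AE y in M. \<forall>k. (T ^^ j (r k)) x y = P n y * a k ((\<phi> ^^ n) y)"
    by (simp add: AE_all_countable)
  with r have "AE y in M. (\<lambda>k. P n y * a k ((\<phi> ^^ n) y)) \<longlonglongrightarrow> g y"
  proof eventually_elim
    case (elim y)
    have "(\<lambda>k. c (r k) y powr (1 / p)) \<longlonglongrightarrow> 0 powr (1 / p)"
      using p_ge_1 by (intro tendsto_powr'[OF elim(1) tendsto_const]) (auto simp: c_def)
    then have "(\<lambda>k. \<bar>(T ^^ j (r k)) x y - g y\<bar>) \<longlonglongrightarrow> 0"
      using p_ge_1 by (simp add: c_def powr_powr)
    then have "(\<lambda>k. (T ^^ j (r k)) x y - g y) \<longlonglongrightarrow> 0"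
      by (rule tendsto_rabs_zero_cancel)
    then show ?case
      using elim(2) by (simp add: LIM_zero_iff)
  qed
  ultimately show ?thesis by blast
qed

text \<open>Approximate \<open>q\<close> and \<open>q \<theta>\<close>, for a positive \<open>q\<close>, by elements \<open>P\<^sub>n (a\<^sub>k \<circ> \<phi>\<^sup>n)\<close> and
  \<open>P\<^sub>n (b\<^sub>k \<circ> \<phi>\<^sup>n)\<close> of the range of \<open>T\<^sup>n\<close>: in the quotient \<open>P\<^sub>n\<close> cancels, so that \<open>\<theta>\<close> is
  the limit of \<open>(b\<^sub>k / a\<^sub>k) \<circ> \<phi>\<^sup>n\<close>.\<close>
lemma bounded_eq_compose_funpow:
  fixes \<theta> :: "'a \<Rightarrow> real"
  assumes [measurable]: "\<theta> \<in> borel_measurable A" and "\<And>y. \<bar>\<theta> y\<bar> \<le> 1"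
  shows "\<exists>\<theta>'\<in>borel_measurable A. AE y in M. \<theta> y = \<theta>' ((\<phi> ^^ n) y)"
proof -
  have [measurable]: "\<theta> \<in> borel_measurable M" by (rule borel_A) fact
  obtain q where q [measurable]: "q \<in> borel_measurable A" and q_pos: "\<And>y. y \<in> space M \<Longrightarrow> 0 < q y"
    and q_int: "(\<integral>\<^sup>+y. ennreal (\<bar>q y\<bar> powr p) \<partial>M) < \<infinity>"
    using Ex_pos_powr_integrable[of p] p_ge_1 by auto
  have [measurable]: "q \<in> borel_measurable M" by (rule borel_A) fact
  have "in_Lp_sub M A p q"
    using q_int by (simp add: in_Lp_sub_def in_Lp_def)
  then obtain a where a [measurable]: "\<And>k. a k \<in> borel_measurable A"
    and a_lim: "AE y in M. (\<lambda>k. P n y * a k ((\<phi> ^^ n) y)) \<longlonglongrightarrow> q y"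
    using range_dense_AE by blast
  have "(\<integral>\<^sup>+y. ennreal (\<bar>q y * \<theta> y\<bar> powr p) \<partial>M) \<le> (\<integral>\<^sup>+y. ennreal (\<bar>q y\<bar> powr p) \<partial>M)"
    using assms(2) p_ge_1
    by (intro nn_integral_mono ennreal_leI powr_mono2) (auto simp: abs_mult mult_left_le)
  then have "in_Lp_sub M A p (\<lambda>y. q y * \<theta> y)"
    using q_int by (auto simp: in_Lp_sub_def in_Lp_def)
  then obtain b where b [measurable]: "\<And>k. b k \<in> borel_measurable A"
    and b_lim: "AE y in M. (\<lambda>k. P n y * b k ((\<phi> ^^ n) y)) \<longlonglongrightarrow> q y * \<theta> y"
    using range_dense_AE by blast
  define \<theta>' where "\<theta>' y = lim (\<lambda>k. b k y / a k y)" for y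
  have "\<theta>' \<in> borel_measurable A"
    unfolding \<theta>'_def by measurable
  moreover have "AE y in M. \<theta> y = \<theta>' ((\<phi> ^^ n) y)"
    using a_lim b_lim AE_space
  proof eventually_elim
    case (elim y)
    have "q y \<noteq> 0"
      using q_pos[of y] elim(3) by auto
    \<comment> \<open>Otherwise all approximants vanish at \<open>y\<close>, while their limit
      \<open>q y\<close> does not.\<close>
    then have "P n y \<noteq> 0"
      using elim(1) by (auto simp: LIMSEQ_const_iff)
    have "(\<lambda>k. (P n y * b k ((\<phi> ^^ n) y)) / (P n y * a k ((\<phi> ^^ n) y))) \<longlonglongrightarrow> (q y * \<theta> y) / q y"
      using elim \<open>q y \<noteq> 0\<close> by (intro tendsto_divide)
    then have "(\<lambda>k. b k ((\<phi> ^^ n) y) / a k ((\<phi> ^^ n) y)) \<longlonglongrightarrow> \<theta> y"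
      using \<open>q y \<noteq> 0\<close> \<open>P n y \<noteq> 0\<close> by simp
    then show ?case
      unfolding \<theta>'_def by (simp add: limI)
  qed
  ultimately show ?thesis by blast
qed

text \<open>Reduces to the bounded case through \<open>f / (1 + \<bar>f\<bar>)\<close>, whose
  inverse transformation is \<open>\<theta> / (1 - \<bar>\<theta>\<bar>)\<close>.\<close>

lemma eq_compose_funpow:
  fixes f :: "'a \<Rightarrow> real"
  assumes [measurable]: "f \<in> borel_measurable A"
  shows "\<exists>f'\<in>borel_measurable A. AE y in M. f y = f' ((\<phi> ^^ n) y)"
proof -
  obtain \<theta> where \<theta> [measurable]: "\<theta> \<in> borel_measurable A"
    and eq: "AE y in M. f y / (1 + \<bar>f y\<bar>) = \<theta> ((\<phi> ^^ n) y)"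
    using bounded_eq_compose_funpow[of "\<lambda>y. f y / (1 + \<bar>f y\<bar>)" n] by auto
  have inv: "f y = (f y / (1 + \<bar>f y\<bar>)) / (1 - \<bar>f y / (1 + \<bar>f y\<bar>)\<bar>)" for y
  proof -
    have "1 - \<bar>f y / (1 + \<bar>f y\<bar>)\<bar> = 1 / (1 + \<bar>f y\<bar>)"
      by (simp add: field_simps)
    then show ?thesis by (simp add: field_simps)
  qed
  have "AE y in M. f y = \<theta> ((\<phi> ^^ n) y) / (1 - \<bar>\<theta> ((\<phi> ^^ n) y)\<bar>)"
    using eq by eventually_elim (use inv in metis)
  then show ?thesis
    by (intro bexI[of _ "\<lambda>y. \<theta> y / (1 - \<bar>\<theta> y\<bar>)"]) simp_all
qed

section \<open>The pulled-back sigma-algebra and conditional expectation onto it\<close>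

abbreviation G :: "nat \<Rightarrow> 'a measure" where "G n \<equiv> vimage_algebra (space M) (\<phi> ^^ n) A"

lemma subalgebra_vimage: "subalgebra M (G n)"
proof -
  have "(\<phi> ^^ n) \<in> space M \<rightarrow> space A"
    using measurable_space[OF funpow_measurable] by (auto simp: space_A)
  then show ?thesis
    using measurable_sets[OF funpow_measurable] sets_A
    by (auto simp: subalgebra_def sets_vimage_algebra2)
qed

lemma compose_funpow_measurable_vimage:
  "f \<in> borel_measurable A \<Longrightarrow> (\<lambda>y. f ((\<phi> ^^ n) y)) \<in> borel_measurable (G n)"
  using measurable_space[OF funpow_measurable]
  by (intro measurable_compose[OF measurable_vimage_algebra1]) (auto simp: space_A)

text \<open>A positive \<open>q\<close> in L^p agrees a.e. with a \<open>G n\<close>-measurable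
  \<open>w\<close>. By Markov's inequality the sets where \<open>w\<close> is at least
  \<open>1 / Suc k\<close> have finite measure; they exhaust the space up to the null set
  \<open>Z\<close>.\<close>

lemma sigma_finite_subalgebra_vimage: "sigma_finite_subalgebra M (G n)"
proof (rule sigma_finite_subalgebra.intro)
  show "subalgebra M (G n)" by (rule subalgebra_vimage)
  show "sigma_finite_measure (restr_to_subalg M (G n))"
  proof
    obtain q where q: "q \<in> borel_measurable A" and q_pos: "\<And>y. y \<in> space M \<Longrightarrow> 0 < q y"
      and q_int: "(\<integral>\<^sup>+y. ennreal (\<bar>q y\<bar> powr p) \<partial>M) < \<infinity>"
      using Ex_pos_powr_integrable[of p] p_ge_1 by auto
    obtain q' where q': "q' \<in> borel_measurable A" and eq: "AE y in M. q y = q' ((\<phi> ^^ n) y)"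
      using eq_compose_funpow[OF q] by blast
    define w where "w y = q' ((\<phi> ^^ n) y)" for y
    have w_G [measurable]: "w \<in> borel_measurable (G n)"
      unfolding w_def by (rule compose_funpow_measurable_vimage[OF q'])
    have w_M [measurable]: "w \<in> borel_measurable M"
      using measurable_from_subalg[OF subalgebra_vimage w_G] .
    have w_int: "(\<integral>\<^sup>+y. ennreal (\<bar>w y\<bar> powr p) \<partial>M) < \<infinity>"
    proof -
      have "(\<integral>\<^sup>+y. ennreal (\<bar>w y\<bar> powr p) \<partial>M) = (\<integral>\<^sup>+y. ennreal (\<bar>q y\<bar> powr p) \<partial>M)"
        by (rule nn_integral_cong_AE) (use eq in \<open>auto simp: w_def\<close>)
      with q_int show ?thesis by simp
    qed
    define B where "B k = {y \<in> space M. 1 / Suc k \<le> w y}" for k :: nat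
    define Z where "Z = {y \<in> space M. w y \<le> 0}"
    have B_G: "B k \<in> sets (G n)" for k
    proof -
      have "{y \<in> space (G n). 1 / Suc k \<le> w y} \<in> sets (G n)" by measurable
      then show ?thesis by (simp add: B_def)
    qed
    have Z_G: "Z \<in> sets (G n)"
    proof -
      have "{y \<in> space (G n). w y \<le> 0} \<in> sets (G n)" by measurable
      then show ?thesis by (simp add: Z_def)
    qed
    have [measurable]: "B k \<in> sets M" "Z \<in> sets M" for k
      using B_G Z_G subalgebra_vimage by (auto simp: subalgebra_def)
    have B_fin: "emeasure M (B k) \<noteq> \<infinity>" for k
    proof -
      obtain D where D: "0 \<le> D" "(\<integral>\<^sup>+y. ennreal (\<bar>w y\<bar> powr p) \<partial>M) = ennreal D"
        using w_int by (cases "\<integral>\<^sup>+y. ennreal (\<bar>w y\<bar> powr p) \<partial>M") auto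
      have "emeasure M (B k) \<le> ennreal (D / (1 / Suc k) powr p)"
      proof (rule Markov_nn_integral[where f = "\<lambda>y. ennreal (\<bar>w y\<bar> powr p)"])
        show "ennreal ((1 / Suc k) powr p) \<le> ennreal (\<bar>w y\<bar> powr p)" if "y \<in> B k" for y
          using that p_ge_1 by (intro ennreal_leI powr_mono2) (auto simp: B_def simp del: of_nat_Suc)
        show "(\<integral>\<^sup>+y\<in>B k. ennreal (\<bar>w y\<bar> powr p) \<partial>M) \<le> ennreal D"
          unfolding D(2)[symmetric] by (intro nn_integral_mono) (auto simp: indicator_def)
      qed (use D in auto)
      then show ?thesis
        by (auto simp: top_unique)
    qed
    have "Z \<in> null_sets M"
    proof -
      have "AE y in M. y \<notin> Z"
        using eq AE_space by eventually_elim (use q_pos in \<open>force simp: Z_def w_def\<close>)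
      then show ?thesis by (simp add: AE_iff_null_sets)
    qed
    then have Z_fin: "emeasure M Z \<noteq> \<infinity>" by auto
    have "space M \<subseteq> Z \<union> (\<Union>k. B k)"
    proof
      fix y assume y: "y \<in> space M"
      show "y \<in> Z \<union> (\<Union>k. B k)"
      proof (cases "w y \<le> 0")
        case False
        then obtain k where "1 / real (Suc k) < w y"
          using reals_Archimedean[of "w y"] by (auto simp: inverse_eq_divide)
        with y show ?thesis by (auto simp: B_def intro!: less_imp_le)
      qed (use y in \<open>simp add: Z_def\<close>)
    qed
    then have "\<Union> (insert Z (range B)) = space M"
      by (auto simp: B_def Z_def)
    then show "\<exists>S. countable S \<and> S \<subseteq> sets (restr_to_subalg M (G n)) \<and>
        \<Union>S = space (restr_to_subalg M (G n)) \<and> (\<forall>a\<in>S. emeasure (restr_to_subalg M (G n)) a \<noteq> \<infinity>)"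
      using B_G Z_G B_fin Z_fin
      by (intro exI[of _ "insert Z (range B)"])
        (auto simp: sets_restr_to_subalg[OF subalgebra_vimage] space_restr_to_subalg
          emeasure_restr_to_subalg[OF subalgebra_vimage])
  qed
qed

text \<open>\<open>P n\<close> is \<open>A\<close>-measurable, hence a.e. equal to a
  \<open>G n\<close>-measurable function, which conditioning leaves unchanged.\<close>

lemma cond_exp_prodEu: "AE y in M. real_cond_exp M (G n) (P n) y = P n y"
proof -
  obtain f' where "f' \<in> borel_measurable A" "AE y in M. P n y = f' ((\<phi> ^^ n) y)"
    using eq_compose_funpow[OF prodEu_measurable_A] by blast
  then show ?thesis
    using compose_funpow_measurable_vimage prodEu_measurable
    by (intro sigma_finite_subalgebra.real_cond_exp_AE_self[OF sigma_finite_subalgebra_vimage]) auto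
qed

abbreviation g_n :: "nat \<Rightarrow> 'a \<Rightarrow> real" where
  "g_n n \<equiv> comp_inv M A \<phi> n (real_cond_exp M (G n) (P n))"

lemma g_n_measurable_A [measurable]: "g_n n \<in> borel_measurable A"
  by (rule comp_inv_measurable) simp

text \<open>Change of variables evaluates \<open>g_n n\<close> only at points
  \<open>(\<phi> ^^ n) y\<close>, where it returns the conditional expectation, that is
  \<open>P n y\<close> a.e.\<close>

lemma nn_integral_h_A_g_n:
  assumes [measurable]: "B \<in> sets A"
  shows "(\<integral>\<^sup>+y\<in>B. h_A M A \<phi> n y * ennreal (\<bar>g_n n y\<bar> powr p) \<partial>M)
    = (\<integral>\<^sup>+y. ennreal (\<bar>P n y\<bar> powr p) * indicator B ((\<phi> ^^ n) y) \<partial>M)"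
proof -
  have "(\<integral>\<^sup>+y\<in>B. h_A M A \<phi> n y * ennreal (\<bar>g_n n y\<bar> powr p) \<partial>M)
      = (\<integral>\<^sup>+y. h_A M A \<phi> n y * (ennreal (\<bar>g_n n y\<bar> powr p) * indicator B y) \<partial>M)"
    by (simp add: mult.assoc)
  also have "\<dots> = (\<integral>\<^sup>+y. ennreal (\<bar>g_n n ((\<phi> ^^ n) y)\<bar> powr p) * indicator B ((\<phi> ^^ n) y) \<partial>M)"
    by (rule nn_integral_h_A) measurable
  also have "\<dots> = (\<integral>\<^sup>+y. ennreal (\<bar>P n y\<bar> powr p) * indicator B ((\<phi> ^^ n) y) \<partial>M)"
  proof (rule nn_integral_cong_AE)
    show "AE y in M. ennreal (\<bar>g_n n ((\<phi> ^^ n) y)\<bar> powr p) * indicator B ((\<phi> ^^ n) y)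
        = ennreal (\<bar>P n y\<bar> powr p) * indicator B ((\<phi> ^^ n) y)"
      using cond_exp_prodEu[of n] AE_space
      by eventually_elim (simp add: comp_inv_eq)
  qed
  finally show ?thesis .
qed

lemma measurable_root_mult [measurable]:
  "(\<lambda>y. root_mult p (h_A M A \<phi> n y) (g_n n y)) \<in> borel_measurable M"
proof -
  have [measurable]: "h_A M A \<phi> n \<in> borel_measurable M" "g_n n \<in> borel_measurable M"
    using h_A_measurable_A g_n_measurable_A borel_A by blast+
  show ?thesis
    unfolding root_mult_def by measurable
qed

lemma measurable_inv_abs [measurable]: "(\<lambda>y. inv_abs (P n y)) \<in> borel_measurable M"
  unfolding inv_abs_def by measurable

section \<open>Construction of the sets and of the exponents\<close>

lemma large_set_exists:
  assumes nonmixing: "finitely_non_mixing M \<phi>" and "0 < \<epsilon>"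
  shows "\<exists>V n. V \<in> sets A \<and> V \<subseteq> F \<and> emeasure M (F - V) \<le> ennreal \<epsilon> \<and>
    esssup_on M V (\<lambda>y. inv_abs (P n y)) \<le> ereal \<epsilon> \<and>
    esssup_on M V (\<lambda>y. root_mult p (h_A M A \<phi> n y) (g_n n y)) \<le> ereal \<epsilon>"
proof -
  have p: "0 < p" using p_ge_1 by simp
  define C where "C = 2 powr p"
  have "0 < C" by (simp add: C_def)
  have half: "(1 / 2) powr p = 1 / C"
    by (simp add: C_def powr_divide)
  \<comment> \<open>Three exceptional sets share \<open>\<epsilon>\<close> equally: the first term
    of the minimum serves \<open>B1\<close> and \<open>B2\<close>, the second serves
    \<open>B3\<close>.\<close>
  define \<delta> where "\<delta> = min (\<epsilon> / (3 * C)) (\<epsilon> * \<epsilon> powr p / (3 * C))"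
  have "0 < \<delta>" and \<delta>1: "C * \<delta> \<le> \<epsilon> / 3" and \<delta>2: "C * \<delta> / \<epsilon> powr p \<le> \<epsilon> / 3"
    using \<open>0 < \<epsilon>\<close> \<open>0 < C\<close> by (auto simp: \<delta>_def min_def field_simps)
  have F_Lp: "in_Lp_sub M A p (indicator F)"
    using indicator_Lp_sub[of 1] by simp
  obtain m where m: "1 \<le> m" "(\<integral>\<^sup>+y. ennreal (\<bar>(T ^^ m) x y - indicator F y\<bar> powr p) \<partial>M) < ennreal \<delta>"
    using orbit_tail_dense[OF F_Lp \<open>0 < \<delta>\<close>, of 1] by auto
  define f where "f = (T ^^ m) x"
  have f_A [measurable]: "f \<in> borel_measurable A"
    unfolding f_def by (rule orbit_measurable_A[OF m(1)])
  have f_M [measurable]: "f \<in> borel_measurable M" by (rule borel_A[OF f_A])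
  \<comment> \<open>Off \<open>H\<close>, a product \<open>P n y * f ((\<phi> ^^ n) y)\<close> of
    modulus at least \<open>1 / 2\<close> forces
    \<open>\<bar>P n y\<bar> \<ge> 1 / \<epsilon>\<close>.\<close>
  define H where "H = {y \<in> space M. \<epsilon> / 2 \<le> \<bar>f y\<bar>}"
  have H_M [measurable]: "H \<in> sets M" unfolding H_def by measurable
  have "emeasure M H < \<infinity>"
  proof -
    obtain D where D: "0 \<le> D" "(\<integral>\<^sup>+y. ennreal (\<bar>f y\<bar> powr p) \<partial>M) = ennreal D"
      using orbit_Lp[of m] by (cases "\<integral>\<^sup>+y. ennreal (\<bar>f y\<bar> powr p) \<partial>M") (auto simp: in_Lp_def f_def)
    have "emeasure M H \<le> ennreal (D / (\<epsilon> / 2) powr p)"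
    proof (rule Markov_nn_integral[where f = "\<lambda>y. ennreal (\<bar>f y\<bar> powr p)"])
      show "ennreal ((\<epsilon> / 2) powr p) \<le> ennreal (\<bar>f y\<bar> powr p)" if "y \<in> H" for y
        using that p \<open>0 < \<epsilon>\<close> by (intro ennreal_leI powr_mono2) (auto simp: H_def)
      show "(\<integral>\<^sup>+y\<in>H. ennreal (\<bar>f y\<bar> powr p) \<partial>M) \<le> ennreal D"
        unfolding D(2)[symmetric] by (intro nn_integral_mono) (auto simp: indicator_def)
    qed (use D \<open>0 < \<epsilon>\<close> in auto)
    then show ?thesis by (rule le_less_trans) simp
  qed
  then have "emeasure M (F \<union> H) < \<infinity>"
    using F_finite emeasure_subadditive[of F M H] by (auto simp: le_less_trans)
  \<comment> \<open>Using the union makes points of \<open>F\<close> leave both \<open>F\<close> and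
    \<open>H\<close> under the same iterate.\<close>
  then obtain N where N: "\<And>n. n > N \<Longrightarrow> (F \<union> H) \<inter> (\<phi> ^^ n) ` (F \<union> H) = {}"
    using nonmixing unfolding finitely_non_mixing_def by (meson F_sets_M H_M sets.Un)
  obtain j where j: "j \<ge> m + N + 1"
    "(\<integral>\<^sup>+y. ennreal (\<bar>(T ^^ j) x y - indicator F y\<bar> powr p) \<partial>M) < ennreal \<delta>"
    using orbit_tail_dense[OF F_Lp \<open>0 < \<delta>\<close>, of "m + N + 1"] by blast
  \<comment> \<open>Now \<open>T ^^ j\<close> applied to \<open>x\<close> is \<open>T ^^ n\<close>
    applied to \<open>f\<close>, a.e. equal to \<open>k\<close> below, and the bound on
    \<open>j\<close> gives \<open>n > N\<close>.\<close>
  define n where "n = j - m"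
  have "n > N" using j(1) by (simp add: n_def)
  have escape: "(\<phi> ^^ n) y \<notin> F \<union> H" if "y \<in> F" for y
    using N[OF \<open>n > N\<close>] that by blast
  define k where "k y = P n y * f ((\<phi> ^^ n) y)" for y
  have [measurable]: "k \<in> borel_measurable A"
    unfolding k_def by measurable
  have [measurable]: "k \<in> borel_measurable M" by (rule borel_A) fact
  have k_int: "(\<integral>\<^sup>+y. ennreal (\<bar>k y - indicator F y\<bar> powr p) \<partial>M) \<le> ennreal \<delta>"
  proof -
    have "AE y in M. (T ^^ j) x y = k y"
      using orbit_eq[OF m(1), of n] j(1) by (simp add: n_def k_def f_def)
    then have "(\<integral>\<^sup>+y. ennreal (\<bar>k y - indicator F y\<bar> powr p) \<partial>M)
        = (\<integral>\<^sup>+y. ennreal (\<bar>(T ^^ j) x y - indicator F y\<bar> powr p) \<partial>M)"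
      by (intro nn_integral_cong_AE) auto
    then show ?thesis using j(2) by simp
  qed
  \<comment> \<open>Stated for general \<open>r\<close> because it is applied to both
    \<open>f\<close> and \<open>k\<close>.\<close>
  have far_small: "emeasure M {y \<in> F. 1 / 2 \<le> \<bar>r y - 1\<bar>} \<le> ennreal (\<epsilon> / 3)"
    if [measurable]: "r \<in> borel_measurable M"
      and r: "(\<integral>\<^sup>+y. ennreal (\<bar>r y - indicator F y\<bar> powr p) \<partial>M) \<le> ennreal \<delta>" for r :: "'a \<Rightarrow> real"
  proof -
    let ?B = "{y \<in> F. 1 / 2 \<le> \<bar>r y - 1\<bar>}"
    have [measurable]: "?B \<in> sets M"
      using sets.sets_into_space[OF F_sets_M] by measurable
    have "emeasure M ?B \<le> ennreal (\<delta> / (1 / 2) powr p)"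
    proof (rule Markov_nn_integral[where f = "\<lambda>y. ennreal (\<bar>r y - indicator F y\<bar> powr p)"])
      show "ennreal ((1 / 2) powr p) \<le> ennreal (\<bar>r y - indicator F y\<bar> powr p)" if "y \<in> ?B" for y
        using that p by (intro ennreal_leI powr_mono2) auto
      show "(\<integral>\<^sup>+y\<in>?B. ennreal (\<bar>r y - indicator F y\<bar> powr p) \<partial>M) \<le> ennreal \<delta>"
        by (rule order_trans[OF _ r]) (intro nn_integral_mono, auto simp: indicator_def)
    qed (use \<open>0 < \<delta>\<close> in auto)
    also have "\<dots> \<le> ennreal (\<epsilon> / 3)"
      unfolding half using \<delta>1 by (intro ennreal_leI) (simp add: mult.commute)
    finally show ?thesis .
  qed
  define B1 where "B1 = {y \<in> F. 1 / 2 \<le> \<bar>f y - 1\<bar>}"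
  define B2 where "B2 = {y \<in> F. 1 / 2 \<le> \<bar>k y - 1\<bar>}"
  define h where "h y = h_A M A \<phi> n y * ennreal (\<bar>g_n n y\<bar> powr p)" for y
  have h_A_meas [measurable]: "h \<in> borel_measurable A"
    unfolding h_def by measurable
  have h_M_meas [measurable]: "h \<in> borel_measurable M" by (rule borel_A[OF h_A_meas])
  \<comment> \<open>Removing \<open>B1\<close> keeps \<open>\<bar>f\<bar>\<close> above
    \<open>1 / 2\<close>, so that \<open>P n\<close> is controlled by \<open>k\<close> on the
    preimage.\<close>
  define B3 where "B3 = {y \<in> F - B1. ennreal (\<epsilon> powr p) < h y}"
  have F_space: "F \<subseteq> space A" using sets.sets_into_space[OF F_sets] .
  note F_sets [measurable]
  have B1_A [measurable]: "B1 \<in> sets A"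
  proof -
    have "B1 = F \<inter> {y \<in> space A. 1 / 2 \<le> \<bar>f y - 1\<bar>}" using F_space by (auto simp: B1_def)
    also have "\<dots> \<in> sets A" by measurable
    finally show ?thesis .
  qed
  have B2_A [measurable]: "B2 \<in> sets A"
  proof -
    have "B2 = F \<inter> {y \<in> space A. 1 / 2 \<le> \<bar>k y - 1\<bar>}" using F_space by (auto simp: B2_def)
    also have "\<dots> \<in> sets A" by measurable
    finally show ?thesis .
  qed
  have B3_A [measurable]: "B3 \<in> sets A"
  proof -
    have "B3 = (F - B1) \<inter> {y \<in> space A. ennreal (\<epsilon> powr p) < h y}" using F_space by (auto simp: B3_def)
    also have "\<dots> \<in> sets A" by measurable
    finally show ?thesis .
  qed
  have [measurable]: "B1 \<in> sets M" "B2 \<in> sets M" "B3 \<in> sets M"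
    using B1_A B2_A B3_A sets_A by auto
  have "emeasure M B1 \<le> ennreal (\<epsilon> / 3)"
    unfolding B1_def by (rule far_small[OF f_M]) (use m(2) in \<open>simp add: f_def\<close>)
  moreover have "emeasure M B2 \<le> ennreal (\<epsilon> / 3)"
    unfolding B2_def by (rule far_small) (use k_int in auto)
  moreover have "emeasure M B3 \<le> ennreal (\<epsilon> / 3)"
  proof -
    have "(\<integral>\<^sup>+y\<in>F - B1. h y \<partial>M) = (\<integral>\<^sup>+y. ennreal (\<bar>P n y\<bar> powr p) * indicator (F - B1) ((\<phi> ^^ n) y) \<partial>M)"
      unfolding h_def by (rule nn_integral_h_A_g_n) measurable
    also have "\<dots> \<le> (\<integral>\<^sup>+y. ennreal C * ennreal (\<bar>k y - indicator F y\<bar> powr p) \<partial>M)"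
    proof (rule nn_integral_mono)
      fix y
      show "ennreal (\<bar>P n y\<bar> powr p) * indicator (F - B1) ((\<phi> ^^ n) y)
          \<le> ennreal C * ennreal (\<bar>k y - indicator F y\<bar> powr p)"
      proof (cases "(\<phi> ^^ n) y \<in> F - B1")
        case True
        \<comment> \<open>\<open>escape\<close> in contrapositive form: the preimage misses
          \<open>F\<close>, so the indicator vanishes and \<open>k\<close> itself is small in the
          mean there.\<close>
        then have "y \<notin> F" using escape by auto
        have "1 / 2 \<le> \<bar>f ((\<phi> ^^ n) y)\<bar>"
          using True by (auto simp: B1_def abs_if split: if_splits)
        then have "\<bar>P n y\<bar> * (1 / 2) \<le> \<bar>P n y\<bar> * \<bar>f ((\<phi> ^^ n) y)\<bar>"
          by (intro mult_left_mono) auto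
        then have "\<bar>P n y\<bar> \<le> 2 * \<bar>k y\<bar>"
          by (simp add: k_def abs_mult)
        then have "\<bar>P n y\<bar> powr p \<le> (2 * \<bar>k y\<bar>) powr p"
          using p by (intro powr_mono2) auto
        then show ?thesis
          using True \<open>y \<notin> F\<close> by (simp add: C_def powr_mult ennreal_leI flip: ennreal_mult)
      qed simp
    qed
    also have "\<dots> = ennreal C * (\<integral>\<^sup>+y. ennreal (\<bar>k y - indicator F y\<bar> powr p) \<partial>M)"
      by (rule nn_integral_cmult) measurable
    also have "\<dots> \<le> ennreal C * ennreal \<delta>"
      using k_int by (intro mult_left_mono) auto
    also have "\<dots> = ennreal (C * \<delta>)"
      using \<open>0 < C\<close> \<open>0 < \<delta>\<close> by (simp add: ennreal_mult)
    finally have le: "(\<integral>\<^sup>+y\<in>F - B1. h y \<partial>M) \<le> ennreal (C * \<delta>)" .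
    have "emeasure M B3 \<le> ennreal (C * \<delta> / \<epsilon> powr p)"
    proof (rule Markov_nn_integral[where f = h])
      show "(\<integral>\<^sup>+y\<in>B3. h y \<partial>M) \<le> ennreal (C * \<delta>)"
        by (rule order_trans[OF _ le]) (intro nn_integral_mono, auto simp: indicator_def B3_def)
    qed (use \<open>0 < C\<close> \<open>0 < \<delta>\<close> \<open>0 < \<epsilon>\<close> in \<open>auto simp: B3_def\<close>)
    also have "\<dots> \<le> ennreal (\<epsilon> / 3)"
      using \<delta>2 by (intro ennreal_leI)
    finally show ?thesis .
  qed
  ultimately have "emeasure M B1 + emeasure M B2 + emeasure M B3
      \<le> ennreal (\<epsilon> / 3) + ennreal (\<epsilon> / 3) + ennreal (\<epsilon> / 3)"
    by (intro add_mono)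
  also have "\<dots> = ennreal \<epsilon>"
    using \<open>0 < \<epsilon>\<close> by (simp flip: ennreal_plus)
  finally have sum: "emeasure M B1 + emeasure M B2 + emeasure M B3 \<le> ennreal \<epsilon>" .
  define V where "V = F - (B1 \<union> B2 \<union> B3)"
  have V_A [measurable]: "V \<in> sets A" unfolding V_def by measurable
  have V_M: "V \<in> sets M" by (rule sets_A[OF V_A])
  have "emeasure M (F - V) \<le> emeasure M (B1 \<union> B2 \<union> B3)"
    by (intro emeasure_mono) (auto simp: V_def)
  also have "\<dots> \<le> emeasure M (B1 \<union> B2) + emeasure M B3"
    by (rule emeasure_subadditive) measurable
  also have "\<dots> \<le> emeasure M B1 + emeasure M B2 + emeasure M B3"
    by (intro add_right_mono emeasure_subadditive) measurable
  finally have "emeasure M (F - V) \<le> ennreal \<epsilon>"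
    using sum by (rule order_trans)
  moreover have "esssup_on M V (\<lambda>y. inv_abs (P n y)) \<le> ereal \<epsilon>"
  proof (rule esssup_on_le[OF measurable_inv_abs V_M])
    fix y assume y: "y \<in> V"
    then have "y \<in> F" "y \<in> space M" using F_space by (auto simp: V_def space_A)
    have "(\<phi> ^^ n) y \<in> space M" using measurable_space[OF funpow_measurable \<open>y \<in> space M\<close>] .
    then have small: "\<bar>f ((\<phi> ^^ n) y)\<bar> \<le> \<epsilon> / 2"
      using escape[OF \<open>y \<in> F\<close>] by (auto simp: H_def)
    have "1 / 2 \<le> \<bar>k y\<bar>"
      using y by (auto simp: V_def B2_def abs_if split: if_splits)
    also have "\<dots> \<le> \<bar>P n y\<bar> * (\<epsilon> / 2)"
      unfolding k_def abs_mult using small by (intro mult_left_mono) auto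
    finally show "\<bar>inv_abs (P n y)\<bar> \<le> ereal \<epsilon>"
      using \<open>0 < \<epsilon>\<close> by (intro inv_abs_le) (auto simp: field_simps)
  qed (use \<open>0 < \<epsilon>\<close> in simp)
  moreover have "esssup_on M V (\<lambda>y. root_mult p (h_A M A \<phi> n y) (g_n n y)) \<le> ereal \<epsilon>"
  proof (rule esssup_on_le[OF measurable_root_mult V_M])
    fix y assume "y \<in> V"
    then have "h y \<le> ennreal (\<epsilon> powr p)" by (auto simp: V_def B3_def)
    then show "\<bar>root_mult p (h_A M A \<phi> n y) (g_n n y)\<bar> \<le> ereal \<epsilon>"
      using p \<open>0 < \<epsilon>\<close> unfolding h_def by (intro root_mult_le)
  qed (use \<open>0 < \<epsilon>\<close> in simp)
  moreover have "V \<subseteq> F" by (auto simp: V_def)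
  ultimately show ?thesis
    using V_A by (intro exI[of _ V] exI[of _ n] conjI)
qed

text \<open>The previous construction with \<open>\<epsilon> = 1 / Suc k\<close>; the essential
  suprema are then squeezed between 0 and \<open>1 / Suc k\<close>.\<close>

lemma large_sets_sequence:
  assumes "finitely_non_mixing M \<phi>"
  shows "\<exists>V n. (\<forall>k. V k \<in> sets A \<and> V k \<subseteq> F) \<and>
    (\<lambda>k. emeasure M (V k)) \<longlonglongrightarrow> emeasure M F \<and>
    (\<lambda>k. esssup_on M (V k) (\<lambda>y. inv_abs (P (n k) y))) \<longlonglongrightarrow> 0 \<and>
    (\<lambda>k. esssup_on M (V k) (\<lambda>y. root_mult p (h_A M A \<phi> (n k) y) (g_n (n k) y))) \<longlonglongrightarrow> 0"
proof -
  define Q where "Q k V n \<longleftrightarrow> V \<in> sets A \<and> V \<subseteq> F \<and> emeasure M (F - V) \<le> ennreal (1 / Suc k) \<and>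
      esssup_on M V (\<lambda>y. inv_abs (P n y)) \<le> ereal (1 / Suc k) \<and>
      esssup_on M V (\<lambda>y. root_mult p (h_A M A \<phi> n y) (g_n n y)) \<le> ereal (1 / Suc k)" for k :: nat and V n
  have "\<exists>V n. Q k V n" for k
    unfolding Q_def by (rule large_set_exists[OF assms]) simp
  then obtain V n where "\<And>k. Q k (V k) (n k)"
    by metis
  then have V: "\<And>k. V k \<in> sets A" "\<And>k. V k \<subseteq> F"
    and diff: "\<And>k. emeasure M (F - V k) \<le> ennreal (1 / Suc k)"
    and inv: "\<And>k. esssup_on M (V k) (\<lambda>y. inv_abs (P (n k) y)) \<le> ereal (1 / Suc k)"
    and root: "\<And>k. esssup_on M (V k) (\<lambda>y. root_mult p (h_A M A \<phi> (n k) y) (g_n (n k) y)) \<le> ereal (1 / Suc k)"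
    by (simp_all only: Q_def)
  have real_lim: "(\<lambda>k. 1 / real (Suc k)) \<longlonglongrightarrow> 0"
    using LIMSEQ_inverse_real_of_nat by (simp add: inverse_eq_divide)
  then have ereal_lim: "(\<lambda>k. ereal (1 / Suc k)) \<longlonglongrightarrow> 0"
    by (simp add: zero_ereal_def)
  have "emeasure M (space M) \<noteq> 0"
    using F_pos emeasure_space[of M F] by (metis not_less)
  note esssup_0 = tendsto_sandwich[OF _ _ tendsto_const ereal_lim] and nonneg = esssup_on_nonneg[OF this]
  have "(\<lambda>k. esssup_on M (V k) (\<lambda>y. inv_abs (P (n k) y))) \<longlonglongrightarrow> 0"
    using inv nonneg by (intro esssup_0) auto
  moreover have "(\<lambda>k. esssup_on M (V k) (\<lambda>y. root_mult p (h_A M A \<phi> (n k) y) (g_n (n k) y))) \<longlonglongrightarrow> 0"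
    using root nonneg by (intro esssup_0) auto
  moreover have "(\<lambda>k. emeasure M (V k)) \<longlonglongrightarrow> emeasure M F"
  proof (rule tendsto_sandwich)
    \<comment> \<open>Subtraction in \<open>ennreal\<close> is truncated at 0, which is harmless in
      a lower bound; the finite measure of \<open>F\<close> makes it continuous.\<close>
    show "\<forall>\<^sub>F k in sequentially. emeasure M F - ennreal (1 / Suc k) \<le> emeasure M (V k)"
    proof (intro always_eventually allI)
      fix k
      have "emeasure M F \<le> emeasure M (V k) + emeasure M (F - V k)"
        using V[of k] sets_A[OF V(1)] emeasure_subadditive[of "V k" M "F - V k"]
        by (simp add: Un_absorb1)
      also have "\<dots> \<le> emeasure M (V k) + ennreal (1 / Suc k)"
        by (intro add_left_mono diff)
      finally show "emeasure M F - ennreal (1 / Suc k) \<le> emeasure M (V k)"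
        by (simp add: ennreal_minus_le_iff add.commute)
    qed
    show "\<forall>\<^sub>F k in sequentially. emeasure M (V k) \<le> emeasure M F"
      using V by (intro always_eventually allI emeasure_mono) auto
    have "(\<lambda>k. emeasure M F - ennreal (1 / Suc k)) \<longlonglongrightarrow> emeasure M F - ennreal 0"
      using F_finite by (intro tendsto_diff_ennreal tendsto_const tendsto_ennrealI real_lim) auto
    then show "(\<lambda>k. emeasure M F - ennreal (1 / Suc k)) \<longlonglongrightarrow> emeasure M F" by simp
  qed (rule tendsto_const)
  ultimately show ?thesis
    using V by (intro exI[of _ V] exI[of _ n] conjI allI)
qed

end

theorem theorem2p4:
  fixes M A :: "'a measure" and p :: real and u :: "'a \<Rightarrow> real" and \<phi> :: "'a \<Rightarrow> 'a"
  assumes "complete_measure M"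
    and "sigma_finite_measure M"
    and "sigma_finite_subalgebra M A"
    and "1 \<le> p"
    and "u \<in> borel_measurable M"
    and "\<phi> \<in> M \<rightarrow>\<^sub>M M"
    and "non_singular M \<phi>"
    and "finitely_non_mixing M \<phi>"
    and "\<forall>B \<in> sets A. \<phi> -` B \<inter> space M \<in> sets A"
    and "\<forall>f. in_Lp M p f \<longrightarrow> in_Lp_sub M A p (cwc_op M A u \<phi> f)"
    and "\<exists>C. \<forall>f. in_Lp M p f \<longrightarrow> Lp_norm M p (cwc_op M A u \<phi> f) \<le> C * Lp_norm M p f"
    and "subspace_hypercyclic M p (cwc_op M A u \<phi>) (in_Lp_sub M A p)"
  shows "\<forall>F \<in> sets A. 0 < emeasure M F \<and> emeasure M F < \<infinity> \<longrightarrow>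
    (\<exists>V :: nat \<Rightarrow> 'a set. \<exists>n :: nat \<Rightarrow> nat.
       (\<forall>k. V k \<in> sets A \<and> V k \<subseteq> F) \<and>
       (\<lambda>k. emeasure M (V k)) \<longlonglongrightarrow> emeasure M F \<and>
       (\<lambda>k. esssup_on M (V k) (\<lambda>x. inv_abs (prodEu M A u \<phi> (n k) x))) \<longlonglongrightarrow> 0 \<and>
       (\<lambda>k. esssup_on M (V k) (\<lambda>x. root_mult p (h_A M A \<phi> (n k) x)
            (comp_inv M A \<phi> (n k)
               (real_cond_exp M (vimage_algebra (space M) (\<phi> ^^ (n k)) A)
                  (prodEu M A u \<phi> (n k))) x))) \<longlonglongrightarrow> 0)"
proof (intro ballI impI)
  fix F assume F: "F \<in> sets A" "0 < emeasure M F \<and> emeasure M F < \<infinity>"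
  obtain x where x: "in_Lp M p x"
    and dense: "\<forall>g. in_Lp_sub M A p g \<longrightarrow> (\<forall>\<epsilon>>0. \<exists>n. in_Lp_sub M A p ((cwc_op M A u \<phi> ^^ n) x) \<and>
      Lp_norm M p (\<lambda>y. (cwc_op M A u \<phi> ^^ n) x y - g y) < \<epsilon>)"
    using assms(12) unfolding subspace_hypercyclic_def by (elim exE conjE)
  interpret weighted_composition M A p u \<phi>
    using assms(3-7,9) by (simp add: weighted_composition_def weighted_composition_axioms_def)
  interpret hypercyclic_composition M A p u \<phi> x F
  proof
    show "in_Lp_sub M A p (T f)" if "in_Lp M p f" for f
      using assms(10) that by (elim allE impE)
    show "\<exists>n. in_Lp_sub M A p ((T ^^ n) x) \<and> Lp_norm M p (\<lambda>y. (T ^^ n) x y - g y) < \<epsilon>"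
      if "in_Lp_sub M A p g" "0 < \<epsilon>" for g \<epsilon>
      using dense[rule_format, OF that] .
  qed (use x F in simp_all)
  show "\<exists>V n. (\<forall>k. V k \<in> sets A \<and> V k \<subseteq> F) \<and>
       (\<lambda>k. emeasure M (V k)) \<longlonglongrightarrow> emeasure M F \<and>
       (\<lambda>k. esssup_on M (V k) (\<lambda>x. inv_abs (prodEu M A u \<phi> (n k) x))) \<longlonglongrightarrow> 0 \<and>
       (\<lambda>k. esssup_on M (V k) (\<lambda>x. root_mult p (h_A M A \<phi> (n k) x)
            (comp_inv M A \<phi> (n k)
               (real_cond_exp M (vimage_algebra (space M) (\<phi> ^^ (n k)) A)
                  (prodEu M A u \<phi> (n k))) x))) \<longlonglongrightarrow> 0"
    by (rule large_sets_sequence[OF assms(8)])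
qed

end
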